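(* Let $d\ge3$. Then $L_d=\ker(\kappa_d)$; equivalently, $r=(r_{\beta,i})_{(\beta,i)\in I_d}\in\mathbb R^{I_d}$ is of the form $\rho_d(a)$ for some $a\in\mathbb R^{\Delta_3^d}$ if and only if, for every $\gamma\in\Delta_3^{d-3}$, $$r_{\gamma+e_3,1}-r_{\gamma+e_2,1}+r_{\gamma+e_1,3}-r_{\gamma+e_2,3}=0\quad\text{and}\quad r_{\gamma+e_3,2}-r_{\gamma+e_1,2}+r_{\gamma+e_2,3}-r_{\gamma+e_1,3}=0.$$ These $2|\Delta_3^{d-3}|=(d-1)(d-2)$ relations (linear functionals of $r$) are linearly independent. Moreover, the sequence $$0\longrightarrow\mathbb R^3\xrightarrow{\ \iota_d\ }\mathbb R^{\Delta_3^d}\xrightarrow{\ \rho_d\ }\mathbb R^{I_d}\xrightarrow{\ \kappa_d\ }\mathbb R^{J_d}\longrightarrow0$$ is exact, where $\iota_d(c_1,c_2,c_3)=(c_1\alpha_1+c_2\alpha_2+c_3\alpha_3)_{\alpha\in\Delta_3^d}$.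
   Context: $\Delta_3^m=\{\alpha\in\mathbb Z_{\ge0}^3:\alpha_1+\alpha_2+\alpha_3=m\}$; $e_1,e_2,e_3$ is the standard basis of $\mathbb R^3$; $[3]=\{1,2,3\}$. $I_d=\Delta_3^{d-2}\times[3]$ and $J_d=\Delta_3^{d-3}\times\{1,2\}$. The linear map $\rho_d:\mathbb R^{\Delta_3^d}\to\mathbb R^{I_d}$ is $(\rho_d(a))_{\beta,i}=a_{\beta+2e_i}+a_{\beta+e_j+e_k}-a_{\beta+e_i+e_j}-a_{\beta+e_i+e_k}$, where $\{i,j,k\}=\{1,2,3\}$; $L_d=\operatorname{im}(\rho_d)$. (If $a_\alpha=\log c_\alpha$ is the array of logarithms of positive coefficients, $(\rho_d(a))_{\beta,i}$ is the logarithm of the ratio $c_{\beta+2e_i}c_{\beta+e_j+e_k}/(c_{\beta+e_i+e_j}c_{\beta+e_i+e_k})$.) The linear map $\kappa_d:\mathbb R^{I_d}\to\mathbb R^{J_d}$ is, for $\gamma\in\Delta_3^{d-3}$, $(\kappa_dr)_{\gamma,1}=r_{\gamma+e_3,1}-r_{\gamma+e_2,1}+r_{\gamma+e_1,3}-r_{\gamma+e_2,3}$ and $(\kappa_dr)_{\gamma,2}=r_{\gamma+e_3,2}-r_{\gamma+e_1,2}+r_{\gamma+e_2,3}-r_{\gamma+e_1,3}$. *)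

theory Defs
  imports "HOL-Analysis.Analysis" "HOL-Library.Function_Algebras"
begin

text \<open>Pointwise scalar multiplication, complementing the pointwise addition of
  \<^theory>\<open>HOL-Library.Function_Algebras\<close>, so that \<^term>\<open>subspace\<close> and \<^term>\<open>independent\<close>
  apply to spaces of functions.\<close>

instantiation "fun" :: (type, real_vector) real_vector
begin

definition scaleR_fun_def: "t *\<^sub>R f = (\<lambda>x. t *\<^sub>R f x)"

instance
  by standard (simp_all add: scaleR_fun_def plus_fun_def fun_eq_iff scaleR_add_right scaleR_add_left)

end

text \<open>The space \<open>\<real>\<^sup>A\<close> for a set \<open>A\<close>: an element is represented by its extension by zero
  outside \<open>A\<close>, so that it is a subspace of a function type.\<close>

definition coord_space :: "'a set \<Rightarrow> ('a \<Rightarrow> real) set" where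
  "coord_space A = {f. \<forall>x. x \<notin> A \<longrightarrow> f x = 0}"

definition linear_map_on ::
    "'a::real_vector set \<Rightarrow> 'b::real_vector set \<Rightarrow> ('a \<Rightarrow> 'b) \<Rightarrow> bool" where
  "linear_map_on V W f \<longleftrightarrow> subspace V \<and> subspace W \<and> f ` V \<subseteq> W \<and>
     (\<forall>x\<in>V. \<forall>y\<in>V. f (x + y) = f x + f y) \<and> (\<forall>t. \<forall>x\<in>V. f (t *\<^sub>R x) = t *\<^sub>R f x)"

definition exact_at ::
    "'a::real_vector set \<Rightarrow> ('a \<Rightarrow> 'b::real_vector) \<Rightarrow> 'b set \<Rightarrow> ('b \<Rightarrow> 'c::real_vector) \<Rightarrow> 'c set \<Rightarrow> bool"
  where
  "exact_at U f V g W \<longleftrightarrow>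
     linear_map_on U V f \<and> linear_map_on V W g \<and> f ` U = {v \<in> V. g v = 0}"

text \<open>The index set \<open>{1,2,3}\<close> is the type \<^typ>\<open>3\<close>, whose arithmetic is modulo 3
  (so that the element \<open>3\<close> equals \<open>0\<close>).\<close>

definition Delta3 :: "nat \<Rightarrow> (nat^3) set" where
  "Delta3 m = {\<alpha>. \<alpha>$1 + \<alpha>$2 + \<alpha>$3 = m}"

definition e :: "3 \<Rightarrow> nat^3" where
  "e i = axis i 1"

definition Iset :: "nat \<Rightarrow> ((nat^3) \<times> 3) set" where
  "Iset d = Delta3 (d - 2) \<times> {1, 2, 3}"

definition Jset :: "nat \<Rightarrow> ((nat^3) \<times> 3) set" where
  "Jset d = Delta3 (d - 3) \<times> {1, 2}"

text \<open>The two indices other than \<open>i\<close> are \<open>i + 1\<close> and \<open>i + 2\<close>, computed modulo 3; the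
  defining expression is symmetric in them (cf. \<open>rho_apply\<close> below).\<close>

definition rho :: "nat \<Rightarrow> (nat^3 \<Rightarrow> real) \<Rightarrow> ((nat^3) \<times> 3 \<Rightarrow> real)" where
  "rho d a = (\<lambda>(\<beta>, i).
     if (\<beta>, i) \<in> Iset d then
       (let j = i + 1; k = i + 2 in
         a (\<beta> + 2 *s e i) + a (\<beta> + e j + e k) - a (\<beta> + e i + e j) - a (\<beta> + e i + e k))
     else 0)"

definition Lspace :: "nat \<Rightarrow> ((nat^3) \<times> 3 \<Rightarrow> real) set" where
  "Lspace d = rho d ` coord_space (Delta3 d)"

definition kappa :: "nat \<Rightarrow> ((nat^3) \<times> 3 \<Rightarrow> real) \<Rightarrow> ((nat^3) \<times> 3 \<Rightarrow> real)" where
  "kappa d r = (\<lambda>(\<gamma>, l).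
     if (\<gamma>, l) \<in> Jset d then
       (if l = 1
        then r (\<gamma> + e 3, 1) - r (\<gamma> + e 2, 1) + r (\<gamma> + e 1, 3) - r (\<gamma> + e 2, 3)
        else r (\<gamma> + e 3, 2) - r (\<gamma> + e 1, 2) + r (\<gamma> + e 2, 3) - r (\<gamma> + e 1, 3))
     else 0)"

definition iota :: "nat \<Rightarrow> real^3 \<Rightarrow> (nat^3 \<Rightarrow> real)" where
  "iota d c = (\<lambda>\<alpha>.
     if \<alpha> \<in> Delta3 d
     then c$1 * real (\<alpha>$1) + c$2 * real (\<alpha>$2) + c$3 * real (\<alpha>$3)
     else 0)"

text \<open>The \<open>j\<close>-th relation as an element of the dual space of \<open>\<real>\<^sup>I\<close>; functionals on \<open>\<real>\<^sup>I\<close> are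
  extended by zero outside \<open>\<real>\<^sup>I\<close>, so that two of them are equal iff they agree on \<open>\<real>\<^sup>I\<close>.\<close>

definition relation_functional :: "nat \<Rightarrow> (nat^3) \<times> 3 \<Rightarrow> (((nat^3) \<times> 3 \<Rightarrow> real) \<Rightarrow> real)" where
  "relation_functional d j = (\<lambda>r. if r \<in> coord_space (Iset d) then kappa d r j else 0)"

lemma rho_apply:
  assumes "\<beta> \<in> Delta3 (d - 2)" and "{i, j, k} = {1, 2, 3}"
  shows "rho d a (\<beta>, i) =
    a (\<beta> + 2 *s e i) + a (\<beta> + e j + e k) - a (\<beta> + e i + e j) - a (\<beta> + e i + e k)"
proof -
  have "card {i, j, k} = 3"
    by (simp add: assms(2))
  then have "i \<noteq> j" "i \<noteq> k" "j \<noteq> k"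
    by (auto simp: card_insert_if split: if_splits)
  then have "j = i + 1 \<and> k = i + 2 \<or> j = i + 2 \<and> k = i + 1"
    using exhaust_3[of i] exhaust_3[of j] exhaust_3[of k] by auto
  moreover have "i \<in> {1, 2, 3}"
    using exhaust_3[of i] by auto
  ultimately show ?thesis
    using assms(1) by (auto simp: rho_def Iset_def Let_def ac_simps)
qed

end

theory Submission
  imports Defs
begin

text \<open>Write \<open>E\<^sub>i\<close> for the shift \<open>f \<mapsto> f (_ + e i)\<close>. Then \<^term>\<open>rho d\<close> consists of the three operators
  \<open>(E\<^sub>i - E\<^sub>j) (E\<^sub>i - E\<^sub>k)\<close>. With \<open>X = E\<^sub>1 - E\<^sub>3\<close> and \<open>Y = E\<^sub>2 - E\<^sub>3\<close> these are \<open>X\<^sup>2 - XY\<close>, \<open>Y\<^sup>2 - XY\<close> and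
  \<open>XY\<close>, so an array \<open>r\<close> carries the same information as the triple
  \<open>p = r\<^sub>1 + r\<^sub>3\<close>, \<open>q = r\<^sub>3\<close>, \<open>s = r\<^sub>2 + r\<^sub>3\<close>, and \<open>r = rho d a\<close> says that \<open>(p, q, s)\<close> is the discrete
  Hessian \<open>(X\<^sup>2 a, XY a, Y\<^sup>2 a)\<close>. In the same terms the two components of \<^term>\<open>kappa d\<close> are
  \<open>X q - Y p\<close> and \<open>Y q - X s\<close>, the integrability conditions of a Hessian.

  Forgetting the third coordinate identifies \<^term>\<open>Delta3 m\<close> with the lattice triangle \<open>x + y \<le> m\<close>,
  on which \<open>X\<close> and \<open>Y\<close> are the forward differences in \<open>x\<close> and \<open>y\<close>. The triangle is a discrete simply
  connected domain: a pair \<open>(u, v)\<close> with \<open>Y u = X v\<close> is a gradient (\<open>discrete_poincare\<close>), and a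
  function with zero gradient is constant. Exactness at \<open>\<real>\<^sup>I\<close> is the Poincare lemma applied to
  \<open>(p, q)\<close>, to \<open>(q, s)\<close> and then to the two potentials so obtained. Exactness
  at \<open>\<real>\<^sup>\<Delta>\<close> says that functions with zero Hessian are affine; they are linear forms in \<open>\<alpha>\<close> because
  the constant \<open>1\<close> equals \<open>(\<alpha>\<^sub>1 + \<alpha>\<^sub>2 + \<alpha>\<^sub>3) / d\<close>. For surjectivity of \<^term>\<open>kappa d\<close> one sets \<open>q = 0\<close>
  and sums the right-hand sides to get \<open>p\<close> and \<open>s\<close>. Linear independence of the
  relations is dual to this surjectivity: for each relation there is an \<open>r\<close> on which it takes the
  value \<open>1\<close> and all others vanish.\<close>

section \<open>Difference calculus on a lattice triangle\<close>

text \<open>The potential at \<open>(x, y)\<close> is the sum along the path that runs from the origin along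
  the first axis and then parallel to the second. This path stays inside the triangle, so only
  values in the region where the hypothesis holds are used.\<close>

lemma discrete_poincare:
  fixes u v :: "nat \<Rightarrow> nat \<Rightarrow> real"
  assumes closed: "\<And>x y. Suc (x + y) < m \<Longrightarrow> u x (Suc y) - u x y = v (Suc x) y - v x y"
  obtains f where "\<And>x y. x + y < m \<Longrightarrow> f (Suc x) y - f x y = u x y"
    and "\<And>x y. f x (Suc y) - f x y = v x y"
proof
  define f where "f x y = (\<Sum>i<x. u i 0) + (\<Sum>j<y. v x j)" for x y
  show "f x (Suc y) - f x y = v x y" for x y
    by (simp add: f_def)
  show "f (Suc x) y - f x y = u x y" if "x + y < m" for x y
  proof -
    have "f (Suc x) y - f x y = u x 0 + (\<Sum>j<y. v (Suc x) j - v x j)"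
      by (simp add: f_def sum_subtractf)
    also have "(\<Sum>j<y. v (Suc x) j - v x j) = (\<Sum>j<y. u x (Suc j) - u x j)"
      by (rule sum.cong) (use that closed in auto)
    also have "\<dots> = u x y - u x 0"
      by (rule sum_lessThan_telescope)
    finally show ?thesis
      by simp
  qed
qed

lemma zero_gradient_constant:
  fixes f :: "nat \<Rightarrow> nat \<Rightarrow> real"
  assumes dx: "\<And>x y. x + y < m \<Longrightarrow> f (Suc x) y = f x y"
    and dy: "\<And>x y. x + y < m \<Longrightarrow> f x (Suc y) = f x y"
    and "x + y \<le> m"
  shows "f x y = f 0 0"
proof -
  have "f x y = f x 0"
    using \<open>x + y \<le> m\<close> by (induction y) (auto simp: dy)
  moreover have "x \<le> m"
    using \<open>x + y \<le> m\<close> by simp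
  then have "f x 0 = f 0 0"
    by (induction x) (auto simp: dx)
  ultimately show ?thesis
    by simp
qed

text \<open>By the two conditions \<open>(p, q)\<close> and \<open>(q, s)\<close> are gradients, say of \<open>b\<close> and \<open>c\<close>. Both the
  \<open>y\<close>-difference of \<open>b\<close> and the \<open>x\<close>-difference of \<open>c\<close> are \<open>q\<close>, so \<open>(b, c)\<close> is again a gradient.\<close>

lemma integrable_hessian:
  fixes p q s :: "nat \<Rightarrow> nat \<Rightarrow> real"
  assumes pq: "\<And>x y. Suc (x + y) < m \<Longrightarrow> p x (Suc y) - p x y = q (Suc x) y - q x y"
    and qs: "\<And>x y. Suc (x + y) < m \<Longrightarrow> q x (Suc y) - q x y = s (Suc x) y - s x y"
  obtains A where
    "\<And>x y. x + y < m \<Longrightarrow> A (Suc (Suc x)) y - 2 * A (Suc x) y + A x y = p x y"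
    "\<And>x y. x + y < m \<Longrightarrow> A (Suc x) (Suc y) - A (Suc x) y - A x (Suc y) + A x y = q x y"
    "\<And>x y. x + y < m \<Longrightarrow> A x (Suc (Suc y)) - 2 * A x (Suc y) + A x y = s x y"
proof -
  obtain b where b: "\<And>x y. x + y < m \<Longrightarrow> b (Suc x) y - b x y = p x y"
      "\<And>x y. b x (Suc y) - b x y = q x y"
    by (rule discrete_poincare[where u = p and v = q and m = m]) (use pq in auto)
  obtain c where c: "\<And>x y. x + y < m \<Longrightarrow> c (Suc x) y - c x y = q x y"
      "\<And>x y. c x (Suc y) - c x y = s x y"
    by (rule discrete_poincare[where u = q and v = s and m = m]) (use qs in auto)
  obtain A where A: "\<And>x y. x + y < Suc m \<Longrightarrow> A (Suc x) y - A x y = b x y"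
      "\<And>x y. A x (Suc y) - A x y = c x y"
    by (rule discrete_poincare[where u = b and v = c and m = "Suc m"]) (simp add: b(2) c(1), auto)
  show thesis
  proof (rule that[of A])
    fix x y assume xy: "x + y < m"
    show "A (Suc (Suc x)) y - 2 * A (Suc x) y + A x y = p x y"
      using A(1)[of "Suc x" y] A(1)[of x y] b(1)[of x y] xy by simp
    show "A (Suc x) (Suc y) - A (Suc x) y - A x (Suc y) + A x y = q x y"
      using A(1)[of x "Suc y"] A(1)[of x y] b(2)[of x y] xy by simp
    show "A x (Suc (Suc y)) - 2 * A x (Suc y) + A x y = s x y"
      using A(2)[of x "Suc y"] A(2)[of x y] c(2)[of x y] by simp
  qed
qed

lemma zero_hessian_affine:
  fixes A :: "nat \<Rightarrow> nat \<Rightarrow> real"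
  assumes xx: "\<And>x y. x + y < m \<Longrightarrow> A (Suc (Suc x)) y - 2 * A (Suc x) y + A x y = 0"
    and xy: "\<And>x y. x + y < m \<Longrightarrow> A (Suc x) (Suc y) - A (Suc x) y - A x (Suc y) + A x y = 0"
    and yy: "\<And>x y. x + y < m \<Longrightarrow> A x (Suc (Suc y)) - 2 * A x (Suc y) + A x y = 0"
    and le: "x + y \<le> Suc m"
  shows "A x y = A 0 0 + real x * (A (Suc 0) 0 - A 0 0) + real y * (A 0 (Suc 0) - A 0 0)"
proof -
  have X: "A (Suc x) y - A x y = A (Suc 0) 0 - A 0 0" if "x + y \<le> m" for x y
    by (rule zero_gradient_constant[where f = "\<lambda>x y. A (Suc x) y - A x y" and m = m])
      (use that xx xy in \<open>force simp: algebra_simps\<close>)+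
  have Y: "A x (Suc y) - A x y = A 0 (Suc 0) - A 0 0" if "x + y \<le> m" for x y
    by (rule zero_gradient_constant[where f = "\<lambda>x y. A x (Suc y) - A x y" and m = m])
      (use that xy yy in \<open>force simp: algebra_simps\<close>)+
  define B where "B x y = A x y - real x * (A (Suc 0) 0 - A 0 0) - real y * (A 0 (Suc 0) - A 0 0)"
    for x y
  have "B x y = B 0 0"
  proof (rule zero_gradient_constant[OF _ _ le])
    fix x y assume "x + y < Suc m"
    then show "B (Suc x) y = B x y" "B x (Suc y) = B x y"
      using X[of x y] Y[of x y] by (auto simp: B_def distrib_right)
  qed
  then show ?thesis
    by (simp add: B_def)
qed

section \<open>The simplex as a lattice triangle\<close>

definition simplex_point :: "nat \<Rightarrow> nat \<Rightarrow> nat \<Rightarrow> nat^3" where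
  "simplex_point m x y = vector [x, y, m - (x + y)]"

lemma simplex_point_nth [simp]:
  "simplex_point m x y $ 1 = x" "simplex_point m x y $ 2 = y"
  "simplex_point m x y $ 3 = m - (x + y)"
  by (simp_all add: simplex_point_def)

lemma simplex_point_in_Delta3: "x + y \<le> m \<Longrightarrow> simplex_point m x y \<in> Delta3 m"
  by (simp add: Delta3_def)

lemma simplex_point_of_coords: "\<alpha> \<in> Delta3 m \<Longrightarrow> simplex_point m (\<alpha> $ 1) (\<alpha> $ 2) = \<alpha>"
  by (auto simp: Delta3_def vec_eq_iff forall_3)

lemma Delta3_eq_image: "Delta3 m = (\<lambda>(x, y). simplex_point m x y) ` {(x, y). x + y \<le> m}"
proof (intro equalityI subsetI)
  fix \<alpha> assume "\<alpha> \<in> Delta3 m"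
  moreover from this have "\<alpha> $ 1 + \<alpha> $ 2 \<le> m"
    by (simp add: Delta3_def)
  ultimately show "\<alpha> \<in> (\<lambda>(x, y). simplex_point m x y) ` {(x, y). x + y \<le> m}"
    using simplex_point_of_coords by (force simp: image_iff)
qed (auto simp: simplex_point_in_Delta3)

lemma Delta3_cases:
  assumes "\<alpha> \<in> Delta3 m"
  obtains x y where "x + y \<le> m" "\<alpha> = simplex_point m x y"
  using assms by (auto simp: Delta3_eq_image)

lemma simplex_point_plus_e:
  assumes "x + y \<le> m"
  shows "simplex_point m x y + e 1 = simplex_point (Suc m) (Suc x) y"
    and "simplex_point m x y + e 2 = simplex_point (Suc m) x (Suc y)"
    and "simplex_point m x y + e 3 = simplex_point (Suc m) x y"
  using assms by (auto simp: vec_eq_iff forall_3 e_def axis_def)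

lemma card_Delta3: "2 * card (Delta3 m) = Suc m * Suc (Suc m)"
proof -
  have "inj_on (\<lambda>(x, y). simplex_point m x y) {(x, y). x + y \<le> m}"
    by (auto simp: inj_on_def vec_eq_iff forall_3)
  then have "card (Delta3 m) = card {(x, y). x + y \<le> m}"
    by (simp add: Delta3_eq_image card_image)
  also have "{(x, y). x + y \<le> m} = (SIGMA x:{..m}. {..m - x})"
    by auto
  also have "card \<dots> = (\<Sum>x\<le>m. Suc (m - x))"
    by (simp add: card_SigmaI)
  also have "2 * \<dots> = Suc m * Suc (Suc m)"
  proof -
    have "(\<Sum>x\<le>m. Suc (m - x)) = (\<Sum>x\<le>m. Suc x)"
      using sum.atLeastAtMost_rev[of "\<lambda>x. Suc x" 0 m] by (simp add: atMost_atLeast0)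
    moreover have "2 * (\<Sum>x\<le>m. Suc x) = Suc m * Suc (Suc m)"
      by (induction m) auto
    ultimately show ?thesis
      by simp
  qed
  finally show ?thesis .
qed

text \<open>The three operators \<open>X\<^sup>2 - XY\<close>, \<open>Y\<^sup>2 - XY\<close> and \<open>XY\<close> in the coordinates \<open>(x, y)\<close>.\<close>

lemma rho_simplex_point:
  fixes a :: "nat^3 \<Rightarrow> real"
  assumes "x + y \<le> m"
  defines "A \<equiv> \<lambda>x y. a (simplex_point (Suc (Suc m)) x y)"
  shows "rho (Suc (Suc m)) a (simplex_point m x y, 1) =
      A (Suc (Suc x)) y + A x (Suc y) - A (Suc x) (Suc y) - A (Suc x) y"
    and "rho (Suc (Suc m)) a (simplex_point m x y, 2) =
      A x (Suc (Suc y)) + A (Suc x) y - A (Suc x) (Suc y) - A x (Suc y)"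
    and "rho (Suc (Suc m)) a (simplex_point m x y, 3) =
      A x y + A (Suc x) (Suc y) - A (Suc x) y - A x (Suc y)"
proof -
  have \<beta>: "simplex_point m x y \<in> Delta3 (Suc (Suc m) - 2)"
    using assms(1) by (simp add: simplex_point_in_Delta3)
  have double: "\<beta> + 2 *s e i = \<beta> + e i + e i" for \<beta> i
    by (simp add: vec_eq_iff)
  show "rho (Suc (Suc m)) a (simplex_point m x y, 1) =
      A (Suc (Suc x)) y + A x (Suc y) - A (Suc x) (Suc y) - A (Suc x) y"
    by (subst rho_apply[OF \<beta>, of 1 2 3]) (use assms(1) in \<open>simp_all add: double simplex_point_plus_e A_def\<close>)
  show "rho (Suc (Suc m)) a (simplex_point m x y, 2) =
      A x (Suc (Suc y)) + A (Suc x) y - A (Suc x) (Suc y) - A x (Suc y)"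
    by (subst rho_apply[OF \<beta>, of 2 1 3]) (use assms(1) in \<open>auto simp: double simplex_point_plus_e A_def\<close>)
  show "rho (Suc (Suc m)) a (simplex_point m x y, 3) =
      A x y + A (Suc x) (Suc y) - A (Suc x) y - A x (Suc y)"
    by (subst rho_apply[OF \<beta>, of 3 1 2]) (use assms(1) in \<open>auto simp: double simplex_point_plus_e A_def\<close>)
qed

lemma kappa_simplex_point:
  fixes r :: "(nat^3) \<times> 3 \<Rightarrow> real"
  assumes "x + y \<le> m"
  defines "R \<equiv> \<lambda>i x y. r (simplex_point (Suc m) x y, i)"
  shows "kappa (Suc (Suc (Suc m))) r (simplex_point m x y, 1) =
      R 1 x y - R 1 x (Suc y) + R 3 (Suc x) y - R 3 x (Suc y)"
    and "kappa (Suc (Suc (Suc m))) r (simplex_point m x y, 2) =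
      R 2 x y - R 2 (Suc x) y + R 3 x (Suc y) - R 3 (Suc x) y"
  using assms(1)
  by (simp_all add: kappa_def Jset_def simplex_point_in_Delta3 simplex_point_plus_e R_def)

section \<open>The maps of the sequence are linear\<close>

lemma scaleR_fun_apply [simp]: "(t *\<^sub>R f) x = t *\<^sub>R f x"
  by (simp add: scaleR_fun_def)

lemma subspace_coord_space: "subspace (coord_space A)"
  by (auto simp: subspace_def coord_space_def)

lemma linear_map_on_rho: "linear_map_on (coord_space (Delta3 d)) (coord_space (Iset d)) (rho d)"
  by (auto simp: linear_map_on_def subspace_coord_space)
    (auto simp: coord_space_def rho_def Let_def fun_eq_iff algebra_simps)

lemma linear_map_on_kappa: "linear_map_on (coord_space (Iset d)) (coord_space (Jset d)) (kappa d)"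
  by (auto simp: linear_map_on_def subspace_coord_space)
    (auto simp: coord_space_def kappa_def fun_eq_iff algebra_simps)

lemma linear_map_on_iota: "linear_map_on UNIV (coord_space (Delta3 d)) (iota d)"
  by (auto simp: linear_map_on_def subspace_coord_space)
    (auto simp: coord_space_def iota_def fun_eq_iff algebra_simps)

section \<open>Exactness\<close>

lemma iota_eq_0_iff:
  assumes "d \<ge> 1"
  shows "iota d c = 0 \<longleftrightarrow> c = 0"
proof
  assume "iota d c = 0"
  then have "iota d c (simplex_point d d 0) = 0" "iota d c (simplex_point d 0 d) = 0"
      "iota d c (simplex_point d 0 0) = 0"
    by simp_all
  then show "c = 0"
    using assms by (auto simp: iota_def simplex_point_in_Delta3 vec_eq_iff forall_3)
qed (simp add: iota_def fun_eq_iff)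

text \<open>Adding the third component of \<^term>\<open>rho d a\<close>, which is \<open>XY a\<close>, to the other two turns \<open>X\<^sup>2 a - XY a\<close> and
  \<open>Y\<^sup>2 a - XY a\<close> into the pure second differences.\<close>

lemma rho_eq_iff_hessian:
  fixes a :: "nat^3 \<Rightarrow> real"
  assumes r: "r \<in> coord_space (Iset (Suc (Suc m)))"
  defines "A \<equiv> \<lambda>x y. a (simplex_point (Suc (Suc m)) x y)"
    and "R \<equiv> \<lambda>i x y. r (simplex_point m x y, i)"
  shows "rho (Suc (Suc m)) a = r \<longleftrightarrow> (\<forall>x y. x + y \<le> m \<longrightarrow>
      A (Suc (Suc x)) y - 2 * A (Suc x) y + A x y = R 1 x y + R 3 x y \<and>
      A (Suc x) (Suc y) - A (Suc x) y - A x (Suc y) + A x y = R 3 x y \<and>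
      A x (Suc (Suc y)) - 2 * A x (Suc y) + A x y = R 2 x y + R 3 x y)"
    (is "_ \<longleftrightarrow> ?hess")
proof -
  have "rho (Suc (Suc m)) a = r \<longleftrightarrow> (\<forall>(\<beta>, i) \<in> Iset (Suc (Suc m)). rho (Suc (Suc m)) a (\<beta>, i) = r (\<beta>, i))"
    using r by (fastforce simp: fun_eq_iff rho_def coord_space_def)
  also have "\<dots> \<longleftrightarrow> (\<forall>x y. x + y \<le> m \<longrightarrow>
      (\<forall>i \<in> {1, 2, 3}. rho (Suc (Suc m)) a (simplex_point m x y, i) = R i x y))"
    unfolding Iset_def R_def by (simp add: Delta3_eq_image)
  also have "\<dots> \<longleftrightarrow> ?hess"
  proof (intro iff_allI imp_cong refl)
    fix x y assume xy: "x + y \<le> m"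
    show "(\<forall>i \<in> {1, 2, 3}. rho (Suc (Suc m)) a (simplex_point m x y, i) = R i x y) \<longleftrightarrow>
      A (Suc (Suc x)) y - 2 * A (Suc x) y + A x y = R 1 x y + R 3 x y \<and>
      A (Suc x) (Suc y) - A (Suc x) y - A x (Suc y) + A x y = R 3 x y \<and>
      A x (Suc (Suc y)) - 2 * A x (Suc y) + A x y = R 2 x y + R 3 x y"
      unfolding ball_simps rho_simplex_point[OF xy] A_def by (auto simp del: One_nat_def)
  qed
  finally show ?thesis .
qed

lemma kappa_eq_0_iff:
  "kappa d r = 0 \<longleftrightarrow> (\<forall>\<gamma> \<in> Delta3 (d - 3). \<forall>l \<in> {1, 2}. kappa d r (\<gamma>, l) = 0)"
proof -
  have "kappa d r = 0 \<longleftrightarrow> (\<forall>(\<gamma>, l) \<in> Jset d. kappa d r (\<gamma>, l) = 0)"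
    by (fastforce simp: fun_eq_iff kappa_def)
  then show ?thesis
    by (simp add: Jset_def)
qed

lemma kappa_eq_0_iff_integrable:
  fixes r :: "(nat^3) \<times> 3 \<Rightarrow> real" and m :: nat
  defines "R \<equiv> \<lambda>i x y. r (simplex_point (Suc m) x y, i)"
  shows "kappa (Suc (Suc (Suc m))) r = 0 \<longleftrightarrow> (\<forall>x y. x + y \<le> m \<longrightarrow>
      (R 1 x (Suc y) + R 3 x (Suc y)) - (R 1 x y + R 3 x y) = R 3 (Suc x) y - R 3 x y \<and>
      R 3 x (Suc y) - R 3 x y = (R 2 (Suc x) y + R 3 (Suc x) y) - (R 2 x y + R 3 x y))"
    (is "_ \<longleftrightarrow> ?int")
proof -
  have "kappa (Suc (Suc (Suc m))) r = 0 \<longleftrightarrow> (\<forall>x y. x + y \<le> m \<longrightarrow>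
      (\<forall>l \<in> {1, 2}. kappa (Suc (Suc (Suc m))) r (simplex_point m x y, l) = 0))"
    unfolding kappa_eq_0_iff by (simp add: Delta3_eq_image)
  also have "\<dots> \<longleftrightarrow> ?int"
  proof (intro iff_allI imp_cong refl)
    fix x y assume xy: "x + y \<le> m"
    show "(\<forall>l \<in> {1, 2}. kappa (Suc (Suc (Suc m))) r (simplex_point m x y, l) = 0) \<longleftrightarrow>
      (R 1 x (Suc y) + R 3 x (Suc y)) - (R 1 x y + R 3 x y) = R 3 (Suc x) y - R 3 x y \<and>
      R 3 x (Suc y) - R 3 x y = (R 2 (Suc x) y + R 3 (Suc x) y) - (R 2 x y + R 3 x y)"
      unfolding ball_simps kappa_simplex_point[OF xy] R_def by auto
  qed
  finally show ?thesis .
qed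

lemma kappa_rho: "kappa (Suc (Suc (Suc m))) (rho (Suc (Suc (Suc m))) a) = 0"
  unfolding kappa_eq_0_iff_integrable
proof (intro allI impI)
  fix x y assume "x + y \<le> m"
  then have le: "x + y \<le> Suc m" "Suc x + y \<le> Suc m" "x + Suc y \<le> Suc m"
    by simp_all
  show "rho (Suc (Suc (Suc m))) a (simplex_point (Suc m) x (Suc y), 1) +
      rho (Suc (Suc (Suc m))) a (simplex_point (Suc m) x (Suc y), 3) -
      (rho (Suc (Suc (Suc m))) a (simplex_point (Suc m) x y, 1) +
       rho (Suc (Suc (Suc m))) a (simplex_point (Suc m) x y, 3)) =
      rho (Suc (Suc (Suc m))) a (simplex_point (Suc m) (Suc x) y, 3) -
      rho (Suc (Suc (Suc m))) a (simplex_point (Suc m) x y, 3) \<and>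
      rho (Suc (Suc (Suc m))) a (simplex_point (Suc m) x (Suc y), 3) -
      rho (Suc (Suc (Suc m))) a (simplex_point (Suc m) x y, 3) =
      rho (Suc (Suc (Suc m))) a (simplex_point (Suc m) (Suc x) y, 2) +
      rho (Suc (Suc (Suc m))) a (simplex_point (Suc m) (Suc x) y, 3) -
      (rho (Suc (Suc (Suc m))) a (simplex_point (Suc m) x y, 2) +
       rho (Suc (Suc (Suc m))) a (simplex_point (Suc m) x y, 3))"
    unfolding le[THEN rho_simplex_point(1)] le[THEN rho_simplex_point(2)]
      le[THEN rho_simplex_point(3)]
    by simp
qed

lemma kappa_eq_0_imp_rho:
  assumes r: "r \<in> coord_space (Iset (Suc (Suc (Suc m))))" and "kappa (Suc (Suc (Suc m))) r = 0"
  obtains a where "a \<in> coord_space (Delta3 (Suc (Suc (Suc m))))" "rho (Suc (Suc (Suc m))) a = r"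
proof -
  define R where "R i x y = r (simplex_point (Suc m) x y, i)" for i x y
  have int: "(R 1 x (Suc y) + R 3 x (Suc y)) - (R 1 x y + R 3 x y) = R 3 (Suc x) y - R 3 x y"
      "R 3 x (Suc y) - R 3 x y = (R 2 (Suc x) y + R 3 (Suc x) y) - (R 2 x y + R 3 x y)"
    if "x + y \<le> m" for x y
    using assms(2)[unfolded kappa_eq_0_iff_integrable, rule_format, OF that]
    by (simp_all only: R_def)
  obtain A where A:
    "\<And>x y. x + y < Suc (Suc m) \<Longrightarrow> A (Suc (Suc x)) y - 2 * A (Suc x) y + A x y = R 1 x y + R 3 x y"
    "\<And>x y. x + y < Suc (Suc m) \<Longrightarrow> A (Suc x) (Suc y) - A (Suc x) y - A x (Suc y) + A x y = R 3 x y"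
    "\<And>x y. x + y < Suc (Suc m) \<Longrightarrow> A x (Suc (Suc y)) - 2 * A x (Suc y) + A x y = R 2 x y + R 3 x y"
    by (rule integrable_hessian[where p = "\<lambda>x y. R 1 x y + R 3 x y" and q = "R 3"
          and s = "\<lambda>x y. R 2 x y + R 3 x y" and m = "Suc (Suc m)"])
      ((rule int, simp)+, auto)
  define a where "a \<alpha> = (if \<alpha> \<in> Delta3 (Suc (Suc (Suc m))) then A (\<alpha> $ 1) (\<alpha> $ 2) else 0)" for \<alpha>
  have a: "a (simplex_point (Suc (Suc (Suc m))) x y) = A x y" if "x + y \<le> Suc (Suc (Suc m))" for x y
    using simplex_point_in_Delta3[OF that] by (simp add: a_def)
  show thesis
  proof
    show "a \<in> coord_space (Delta3 (Suc (Suc (Suc m))))"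
      by (simp add: coord_space_def a_def)
    show "rho (Suc (Suc (Suc m))) a = r"
      unfolding rho_eq_iff_hessian[OF r]
    proof (intro allI impI)
      fix x y assume "x + y \<le> Suc m"
      then show "a (simplex_point (Suc (Suc (Suc m))) (Suc (Suc x)) y) - 2 * a (simplex_point (Suc (Suc (Suc m))) (Suc x) y) +
            a (simplex_point (Suc (Suc (Suc m))) x y) =
            r (simplex_point (Suc m) x y, 1) + r (simplex_point (Suc m) x y, 3) \<and>
          a (simplex_point (Suc (Suc (Suc m))) (Suc x) (Suc y)) - a (simplex_point (Suc (Suc (Suc m))) (Suc x) y) -
            a (simplex_point (Suc (Suc (Suc m))) x (Suc y)) + a (simplex_point (Suc (Suc (Suc m))) x y) =
            r (simplex_point (Suc m) x y, 3) \<and>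
          a (simplex_point (Suc (Suc (Suc m))) x (Suc (Suc y))) - 2 * a (simplex_point (Suc (Suc (Suc m))) x (Suc y)) +
            a (simplex_point (Suc (Suc (Suc m))) x y) =
            r (simplex_point (Suc m) x y, 2) + r (simplex_point (Suc m) x y, 3)"
        using A[of x y] by (simp add: a R_def)
    qed
  qed
qed

lemma rho_iota: "rho (Suc (Suc m)) (iota (Suc (Suc m)) c) = 0"
proof -
  have zero: "0 \<in> coord_space (Iset (Suc (Suc m)))"
    by (simp add: coord_space_def)
  have lin: "iota (Suc (Suc m)) c (simplex_point (Suc (Suc m)) x y) =
      c $ 1 * real x + c $ 2 * real y + c $ 3 * (real (Suc (Suc m)) - real x - real y)"
    if "x + y \<le> Suc (Suc m)" for x y
    using that simplex_point_in_Delta3[OF that] by (simp add: iota_def of_nat_diff)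
  show ?thesis
    unfolding rho_eq_iff_hessian[OF zero] by (simp add: lin algebra_simps)
qed

text \<open>An array with zero Hessian is affine in \<open>(x, y)\<close>; it remains to homogenize.\<close>

lemma rho_eq_0_imp_iota:
  assumes a: "a \<in> coord_space (Delta3 (Suc (Suc m)))" and "rho (Suc (Suc m)) a = 0"
  obtains c where "iota (Suc (Suc m)) c = a"
proof -
  define A where "A x y = a (simplex_point (Suc (Suc m)) x y)" for x y
  have "0 \<in> coord_space (Iset (Suc (Suc m)))"
    by (simp add: coord_space_def)
  from rho_eq_iff_hessian[OF this, of a] assms(2)
  have hess: "A (Suc (Suc x)) y - 2 * A (Suc x) y + A x y = 0"
      "A (Suc x) (Suc y) - A (Suc x) y - A x (Suc y) + A x y = 0"
      "A x (Suc (Suc y)) - 2 * A x (Suc y) + A x y = 0" if "x + y < Suc m" for x y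
    using that by (auto simp: A_def)
  \<comment> \<open>The constant term is spread evenly over the coordinates, which sum to \<open>m + 2\<close>.\<close>
  define t where "t = A 0 0 / real (Suc (Suc m))"
  define c :: "real^3" where
    "c = vector [t + (A (Suc 0) 0 - A 0 0), t + (A 0 (Suc 0) - A 0 0), t]"
  have t: "t * real (Suc (Suc m)) = A 0 0"
    by (simp add: t_def)
  have "iota (Suc (Suc m)) c \<alpha> = a \<alpha>" for \<alpha>
  proof (cases "\<alpha> \<in> Delta3 (Suc (Suc m))")
    case True
    then obtain x y where xy: "x + y \<le> Suc (Suc m)" "\<alpha> = simplex_point (Suc (Suc m)) x y"
      by (rule Delta3_cases)
    have "iota (Suc (Suc m)) c \<alpha> =
        t * real (Suc (Suc m)) + real x * (A (Suc 0) 0 - A 0 0) + real y * (A 0 (Suc 0) - A 0 0)"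
      using True xy by (simp add: iota_def c_def of_nat_diff algebra_simps)
    also have "\<dots> = A x y"
      using zero_hessian_affine[of "Suc m" A x y] hess xy(1) by (simp only: t)
    finally show ?thesis
      by (simp add: xy(2) A_def)
  qed (use a in \<open>simp add: iota_def coord_space_def\<close>)
  then show thesis
    using that by blast
qed

text \<open>A preimage with \<open>q = 0\<close>: then \<open>r\<^sub>1 = p\<close> and \<open>r\<^sub>2 = s\<close>, and the equations
  \<open>- Y p = g\<^sub>1\<close>, \<open>- X s = g\<^sub>2\<close> are solved separately by summation.\<close>

lemma kappa_surj:
  assumes g: "g \<in> coord_space (Jset (Suc (Suc (Suc m))))"
  obtains r where "r \<in> coord_space (Iset (Suc (Suc (Suc m))))" "kappa (Suc (Suc (Suc m))) r = g"
proof -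
  define p where "p x y = - (\<Sum>j<y. g (simplex_point m x j, 1))" for x y
  define s where "s x y = - (\<Sum>i<x. g (simplex_point m i y, 2))" for x y
  define r where "r = (\<lambda>(\<beta>, i). if (\<beta>, i) \<in> Iset (Suc (Suc (Suc m))) then
      (if i = 1 then p (\<beta> $ 1) (\<beta> $ 2) else if i = 2 then s (\<beta> $ 1) (\<beta> $ 2) else 0) else 0)"
  have r: "r (simplex_point (Suc m) x y, 1) = p x y" "r (simplex_point (Suc m) x y, 2) = s x y"
      "r (simplex_point (Suc m) x y, 3) = 0" if "x + y \<le> Suc m" for x y
    using that simplex_point_in_Delta3[OF that] by (auto simp: r_def Iset_def)
  have "kappa (Suc (Suc (Suc m))) r (\<gamma>, l) = g (\<gamma>, l)" for \<gamma> l
  proof (cases "(\<gamma>, l) \<in> Jset (Suc (Suc (Suc m)))")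
    case True
    then have "\<gamma> \<in> Delta3 m" and l: "l = 1 \<or> l = 2"
      by (auto simp: Jset_def)
    then obtain x y where xy: "x + y \<le> m" and \<gamma>: "\<gamma> = simplex_point m x y"
      using Delta3_cases by blast
    show ?thesis
      using l
    proof
      assume "l = 1"
      then show ?thesis
        using xy by (simp add: \<gamma> kappa_simplex_point[OF xy] r) (simp add: p_def)
    next
      assume "l = 2"
      then show ?thesis
        using xy by (simp add: \<gamma> kappa_simplex_point[OF xy] r) (simp add: s_def)
    qed
  next
    case False
    with g show ?thesis
      by (auto simp: kappa_def coord_space_def)
  qed
  moreover have "r \<in> coord_space (Iset (Suc (Suc (Suc m))))"
    by (auto simp: coord_space_def r_def)
  ultimately show thesis
    using that by (auto simp: fun_eq_iff)
qed

section \<open>Independence of the relations\<close>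

text \<open>Evaluation at \<open>x\<^sub>j\<close> separates \<open>\<phi>\<^sub>j\<close> from the subspace of functions vanishing at \<open>x\<^sub>j\<close>, which
  contains the span of all the other members of the family.\<close>

lemma biorthogonal_imp_independent:
  fixes \<phi> :: "'j \<Rightarrow> 'a \<Rightarrow> real"
  assumes dual: "\<And>i j. i \<in> J \<Longrightarrow> j \<in> J \<Longrightarrow> \<phi> i (x j) = (if i = j then 1 else 0)"
  shows "inj_on \<phi> J" and "independent (\<phi> ` J)"
proof -
  show "inj_on \<phi> J"
    by (metis (mono_tags) dual inj_onI zero_neq_one)
  show "independent (\<phi> ` J)"
    unfolding dependent_def
  proof clarsimp
    fix j assume j: "j \<in> J" "\<phi> j \<in> span (\<phi> ` J - {\<phi> j})"
    have "subspace {f :: 'a \<Rightarrow> real. f (x j) = 0}"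
      by (simp add: subspace_def)
    moreover have "\<phi> ` J - {\<phi> j} \<subseteq> {f. f (x j) = 0}"
      using dual j(1) by auto
    ultimately have "span (\<phi> ` J - {\<phi> j}) \<subseteq> {f. f (x j) = 0}"
      by (intro span_minimal)
    with j dual show False
      by auto
  qed
qed

lemma relation_functionals_independent:
  "inj_on (relation_functional (Suc (Suc (Suc m)))) (Jset (Suc (Suc (Suc m))))"
  "independent (relation_functional (Suc (Suc (Suc m))) ` Jset (Suc (Suc (Suc m))))"
proof -
  have "\<exists>r. r \<in> coord_space (Iset (Suc (Suc (Suc m)))) \<and>
      kappa (Suc (Suc (Suc m))) r = (\<lambda>i. if i = j then 1 else 0)" if "j \<in> Jset (Suc (Suc (Suc m)))" for j
  proof -
    have "(\<lambda>i. if i = j then 1 else 0) \<in> coord_space (Jset (Suc (Suc (Suc m))))"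
      using that by (auto simp: coord_space_def)
    then show ?thesis
      by (rule kappa_surj) blast
  qed
  then obtain x where x: "\<And>j. j \<in> Jset (Suc (Suc (Suc m))) \<Longrightarrow> x j \<in> coord_space (Iset (Suc (Suc (Suc m)))) \<and>
      kappa (Suc (Suc (Suc m))) (x j) = (\<lambda>i. if i = j then 1 else 0)"
    by metis
  have dual: "relation_functional (Suc (Suc (Suc m))) i (x j) = (if i = j then 1 else 0)"
    if "i \<in> Jset (Suc (Suc (Suc m)))" "j \<in> Jset (Suc (Suc (Suc m)))" for i j
    using x[OF that(2)] by (simp add: relation_functional_def)
  show "inj_on (relation_functional (Suc (Suc (Suc m)))) (Jset (Suc (Suc (Suc m))))"
    and "independent (relation_functional (Suc (Suc (Suc m))) ` Jset (Suc (Suc (Suc m))))"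
    by (rule biorthogonal_imp_independent[where x = x]; fact dual)+
qed

section \<open>The exact sequence\<close>

theorem theorem5p3:
  fixes d :: nat
  assumes "d \<ge> 3"
  shows "Lspace d = {r \<in> coord_space (Iset d). kappa d r = 0} \<and>
    (\<forall>r \<in> coord_space (Iset d).
      (\<exists>a \<in> coord_space (Delta3 d). r = rho d a) \<longleftrightarrow>
      (\<forall>\<gamma> \<in> Delta3 (d - 3).
        r (\<gamma> + e 3, 1) - r (\<gamma> + e 2, 1) + r (\<gamma> + e 1, 3) - r (\<gamma> + e 2, 3) = 0 \<and>
        r (\<gamma> + e 3, 2) - r (\<gamma> + e 1, 2) + r (\<gamma> + e 2, 3) - r (\<gamma> + e 1, 3) = 0)) \<and>
    card (Jset d) = 2 * card (Delta3 (d - 3)) \<and>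
    2 * card (Delta3 (d - 3)) = (d - 1) * (d - 2) \<and>
    inj_on (relation_functional d) (Jset d) \<and>
    independent (relation_functional d ` Jset d) \<and>
    exact_at {0 :: real} (\<lambda>_. 0) UNIV (iota d) (coord_space (Delta3 d)) \<and>
    exact_at UNIV (iota d) (coord_space (Delta3 d)) (rho d) (coord_space (Iset d)) \<and>
    exact_at (coord_space (Delta3 d)) (rho d) (coord_space (Iset d))
           (kappa d) (coord_space (Jset d)) \<and>
    exact_at (coord_space (Iset d)) (kappa d) (coord_space (Jset d)) (\<lambda>_. 0) {0 :: real}"
proof -
  obtain m where d: "d = Suc (Suc (Suc m))"
    using le_Suc_ex[OF assms] by (auto simp: eval_nat_numeral)
  have zero_left: "exact_at {0 :: real} (\<lambda>_. 0) UNIV (iota d) (coord_space (Delta3 d))"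
    using assms linear_map_on_iota[of d]
    by (auto simp: exact_at_def linear_map_on_def iota_eq_0_iff)
  have at_Delta: "exact_at UNIV (iota d) (coord_space (Delta3 d)) (rho d) (coord_space (Iset d))"
  proof -
    have "range (iota d) \<subseteq> {a \<in> coord_space (Delta3 d). rho d a = 0}"
      using linear_map_on_iota[of d] rho_iota[of "Suc m"] unfolding linear_map_on_def d by blast
    moreover have "{a \<in> coord_space (Delta3 d). rho d a = 0} \<subseteq> range (iota d)"
      unfolding d using rho_eq_0_imp_iota[of _ "Suc m"] by blast
    ultimately show ?thesis
      unfolding exact_at_def using linear_map_on_iota linear_map_on_rho by blast
  qed
  have L: "rho d ` coord_space (Delta3 d) = {r \<in> coord_space (Iset d). kappa d r = 0}"
  proof
    show "rho d ` coord_space (Delta3 d) \<subseteq> {r \<in> coord_space (Iset d). kappa d r = 0}"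
      using linear_map_on_rho[of d] kappa_rho[of m] unfolding linear_map_on_def d by blast
    show "{r \<in> coord_space (Iset d). kappa d r = 0} \<subseteq> rho d ` coord_space (Delta3 d)"
      unfolding d using kappa_eq_0_imp_rho[of _ m] by blast
  qed
  then have at_I: "exact_at (coord_space (Delta3 d)) (rho d) (coord_space (Iset d))
      (kappa d) (coord_space (Jset d))"
    unfolding exact_at_def using linear_map_on_rho linear_map_on_kappa by blast
  have zero_right:
    "exact_at (coord_space (Iset d)) (kappa d) (coord_space (Jset d)) (\<lambda>_. 0) {0 :: real}"
  proof -
    have "coord_space (Jset d) \<subseteq> kappa d ` coord_space (Iset d)"
      unfolding d using kappa_surj[of _ m] by blast
    then show ?thesis
      using linear_map_on_kappa[of d] by (auto simp: exact_at_def linear_map_on_def)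
  qed
  have relations: "kappa d r = 0 \<longleftrightarrow> (\<forall>\<gamma> \<in> Delta3 (d - 3).
        r (\<gamma> + e 3, 1) - r (\<gamma> + e 2, 1) + r (\<gamma> + e 1, 3) - r (\<gamma> + e 2, 3) = 0 \<and>
        r (\<gamma> + e 3, 2) - r (\<gamma> + e 1, 2) + r (\<gamma> + e 2, 3) - r (\<gamma> + e 1, 3) = 0)" for r
    unfolding kappa_eq_0_iff by (simp add: kappa_def Jset_def)
  have "card (Jset d) = 2 * card (Delta3 (d - 3))"
    by (simp add: Jset_def card_cartesian_product)
  moreover have "2 * card (Delta3 (d - 3)) = (d - 1) * (d - 2)"
    using card_Delta3[of m] by (simp add: d)
  moreover have "(\<exists>a \<in> coord_space (Delta3 d). r = rho d a) \<longleftrightarrow> kappa d r = 0"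
    if "r \<in> coord_space (Iset d)" for r
    using L that by blast
  ultimately show ?thesis
    using zero_left at_Delta at_I zero_right L relation_functionals_independent[of m]
    unfolding Lspace_def relations[symmetric] d[symmetric] by blast
qed

end
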